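(* For all $a\in(0,1)$, all even nonnegative integers $k\in\{2n : n\in\mathbb{N}_0\}$ and all $x\in(1,\infty)$, $$\frac{a\,k!}{x^{k+1}}<\psi^{(k)}(x+a)-\psi^{(k)}(x)<\psi^{(k)}(a)-\psi^{(k)}(1)+k!\left(\frac{a}{x^{k+1}}+\frac{1}{a^{k+1}}-a\right).$$
   Context: $\mathbb{N}_0=\{0,1,2,\dots\}$. $\Gamma$ is the classical Gamma function, $\psi(x)=\frac{d}{dx}\ln\Gamma(x)$ for $x>0$ is the digamma function, $\psi^{(k)}$ is its $k$-th derivative (polygamma function), and $\psi^{(0)}=\psi$. *)

theory Defs
  imports "HOL-Analysis.Analysis"
begin

text \<open>
  The library defines \<^term>\<open>Polygamma n x\<close> by a series. The following fact identifies it, on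
  the positive reals, with the \<open>n\<close>-th derivative of \<open>d/dx ln (Gamma x)\<close>.
\<close>

lemma higher_deriv_ln_Gamma_eq_Polygamma:
  fixes x :: real
  assumes "x > 0"
  shows "(deriv ^^ n) (deriv (\<lambda>t. ln (Gamma t))) x = Polygamma n x"
proof -
  have ev: "eventually (\<lambda>u. ln (Gamma u) = ln_Gamma u) (nhds y)" if "y > 0" for y :: real
    using eventually_nhds_in_open[of "{0<..}" y] that
    by (auto elim!: eventually_mono simp: Gamma_real_pos_exp)
  have "(deriv ^^ Suc n) (\<lambda>t. ln (Gamma t)) x = (deriv ^^ Suc n) ln_Gamma x"
    by (rule higher_deriv_cong_ev[OF ev[OF assms] refl])
  also have "\<dots> = Polygamma n x"
    using assms by (subst higher_deriv_ln_Gamma_real) auto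
  finally show ?thesis
    by (simp add: funpow_swap1)
qed

end

theory Submission
  imports Defs
begin

text \<open>
  For even \<open>k\<close>, the function \<open>g x = \<psi>\<^sup>(\<^sup>k\<^sup>)(x + a) - \<psi>\<^sup>(\<^sup>k\<^sup>)(x) - a k! / x\<^sup>k\<^sup>+\<^sup>1\<close> tends to \<open>0\<close> at infinity, and by the
  recurrence of the polygamma function \<open>g x - g (x + 1)\<close> is \<open>k!\<close> times the amount by which the chord
  of \<open>t \<mapsto> 1 / t\<^sup>k\<^sup>+\<^sup>1\<close> over \<open>[x, x + 1]\<close> exceeds this function at \<open>x + a\<close>. Hence \<open>g\<close> is the sum of
  these gaps over the translates \<open>x + n\<close>. Strict convexity makes each gap positive; as the derivative
  of a gap is a negative multiple of the gap for the next exponent, each gap is also strictly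
  decreasing in \<open>x\<close>. The two bounds say that \<open>g x > 0\<close> and \<open>g x < g 1\<close>.
\<close>

definition chord_gap :: "real \<Rightarrow> nat \<Rightarrow> real \<Rightarrow> real" where
  "chord_gap a m y = (1 - a) / y ^ m + a / (y + 1) ^ m - 1 / (y + a) ^ m"

text \<open>Multiplying the hypothesis by the bound for exponent \<open>Suc n\<close> leaves a
  surplus \<open>a * (1 - a) * ((p - q) * (p ^ Suc n - q ^ Suc n))\<close>, nonnegative because
  powers preserve the order of \<open>p\<close> and \<open>q\<close>.\<close>

lemma power_convex_combination:
  fixes a p q r :: real
  assumes "0 < a" "a < 1" "0 < p" "0 < q" "0 < r" "r < (1 - a) * p + a * q"
  shows "r ^ Suc n < (1 - a) * p ^ Suc n + a * q ^ Suc n"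
proof (induction n)
  case 0
  then show ?case using assms by simp
next
  case (Suc n)
  have mono: "(p - q) * (p ^ Suc n - q ^ Suc n) \<ge> 0"
  proof (cases "p \<le> q")
    case True
    then show ?thesis using assms power_mono[of p q "Suc n"] by (intro mult_nonpos_nonpos) auto
  next
    case False
    then show ?thesis using assms power_mono[of q p "Suc n"] by (intro mult_nonneg_nonneg) auto
  qed
  have "r ^ Suc (Suc n) < ((1 - a) * p + a * q) * ((1 - a) * p ^ Suc n + a * q ^ Suc n)"
    unfolding power_Suc[of r "Suc n"] using Suc assms by (intro mult_strict_mono) auto
  also have "\<dots> = (1 - a) * p ^ Suc (Suc n) + a * q ^ Suc (Suc n)
      - a * (1 - a) * ((p - q) * (p ^ Suc n - q ^ Suc n))"
    by (simp add: algebra_simps)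
  also have "\<dots> \<le> (1 - a) * p ^ Suc (Suc n) + a * q ^ Suc (Suc n)"
    using mono assms by simp
  finally show ?case .
qed

text \<open>Exponent 1 is an explicit computation; \<open>power_convex_combination\<close>, applied
  to the reciprocals of \<open>y\<close>, \<open>y + 1\<close> and \<open>y + a\<close>, lifts it to
  every higher exponent.\<close>

lemma chord_gap_pos:
  assumes "0 < a" "a < 1" "0 < y"
  shows "0 < chord_gap a (Suc n) y"
proof -
  have "(1 - a) * (1 / y) + a * (1 / (y + 1)) - 1 / (y + a)
      = a * (1 - a) / (y * (y + 1) * (y + a))"
    using assms by (simp add: divide_simps) (simp add: algebra_simps)
  also have "\<dots> > 0"
    using assms by simp
  finally have "1 / (y + a) < (1 - a) * (1 / y) + a * (1 / (y + 1))"
    by simp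
  from power_convex_combination[OF assms(1,2) _ _ _ this, of n] assms show ?thesis
    by (simp add: chord_gap_def power_one_over field_simps)
qed

lemma has_real_derivative_inverse_power:
  fixes c y :: real
  assumes "y + c > 0"
  shows "((\<lambda>y. 1 / (y + c) ^ m) has_real_derivative - real m / (y + c) ^ Suc m) (at y)"
proof (cases m)
  case (Suc n)
  have "((\<lambda>y. 1 / (y + c) ^ Suc n) has_real_derivative
      - (real (Suc n) * (y + c) ^ n) / ((y + c) ^ Suc n * (y + c) ^ Suc n)) (at y)"
    using assms by (auto intro!: derivative_eq_intros simp del: power_Suc)
  also have "- (real (Suc n) * (y + c) ^ n) / ((y + c) ^ Suc n * (y + c) ^ Suc n)
      = - real (Suc n) / (y + c) ^ Suc (Suc n)"
    using assms by (simp add: divide_simps del: of_nat_Suc)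
  finally show ?thesis
    unfolding Suc .
qed simp

lemma has_real_derivative_chord_gap:
  assumes "0 < a" "0 < y"
  shows "(chord_gap a m has_real_derivative - real m * chord_gap a (Suc m) y) (at y)"
proof -
  \<comment> \<open>The shift \<open>y + 0\<close> lets one derivative rule cover all three
    terms.\<close>
  have "((\<lambda>y. (1 - a) * (1 / (y + 0) ^ m) + a * (1 / (y + 1) ^ m) - 1 / (y + a) ^ m)
     has_real_derivative
     (1 - a) * (- real m / (y + 0) ^ Suc m) + a * (- real m / (y + 1) ^ Suc m)
       - (- real m / (y + a) ^ Suc m)) (at y)"
    using assms
    by (intro DERIV_diff DERIV_add DERIV_cmult has_real_derivative_inverse_power) auto
  moreover have "chord_gap a m
      = (\<lambda>y. (1 - a) * (1 / (y + 0) ^ m) + a * (1 / (y + 1) ^ m) - 1 / (y + a) ^ m)"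
    by (simp add: chord_gap_def fun_eq_iff)
  moreover have "- real m * chord_gap a (Suc m) y
      = (1 - a) * (- real m / (y + 0) ^ Suc m) + a * (- real m / (y + 1) ^ Suc m)
        - (- real m / (y + a) ^ Suc m)"
    unfolding chord_gap_def by (simp add: algebra_simps diff_divide_distrib)
  ultimately show ?thesis by metis
qed

lemma chord_gap_strict_antimono:
  assumes "0 < a" "a < 1" "0 < y" "y < z"
  shows "chord_gap a (Suc n) z < chord_gap a (Suc n) y"
proof (rule DERIV_neg_imp_decreasing[OF assms(4)])
  fix t assume "y \<le> t" "t \<le> z"
  with assms have "0 < t" by simp
  then show "\<exists>d. (chord_gap a (Suc n) has_real_derivative d) (at t) \<and> d < 0"
    using has_real_derivative_chord_gap[of a t "Suc n"] chord_gap_pos[of a t "Suc n"] assms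
    by (intro exI[of _ "- real (Suc n) * chord_gap a (Suc (Suc n)) t"] conjI)
       (auto simp: mult_neg_pos)
qed

lemma Polygamma_diff_sums_chord_gap:
  fixes a x :: real
  assumes "0 < a" "a < 1" "even k" "0 < x"
  shows "(\<lambda>n. fact k * chord_gap a (Suc k) (x + real n))
    sums (Polygamma k (x + a) - Polygamma k x - a * fact k / x ^ Suc k)"
proof -
  define d where "d y = Polygamma k (y + a) - Polygamma k y" for y :: real
  define g where "g y = d y - a * fact k / y ^ Suc k" for y
  \<comment> \<open>Evenness of \<open>k\<close> removes the sign \<open>(-1) ^ k\<close> from the
    recurrence.\<close>
  have step: "Polygamma k (y + 1) = Polygamma k y + fact k / y ^ Suc k" if "0 < y" for y :: real
    using Polygamma_plus1[of y k] that assms(3) by simp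
  have lim: "(\<lambda>n. c / (x + real n) ^ Suc k) \<longlonglongrightarrow> 0" for c :: real
    by (intro tendsto_divide_0[OF tendsto_const] filterlim_at_top_imp_at_infinity
          filterlim_pow_at_top filterlim_tendsto_add_at_top[OF tendsto_const]
          filterlim_real_sequentially) simp
  \<comment> \<open>For even \<open>k\<close>, \<open>Polygamma k\<close> is increasing on the
    positive reals, so \<open>a < 1\<close> puts \<open>d y\<close> between 0 and the increment over
    a unit step, which \<open>step\<close> evaluates.\<close>
  have "(\<lambda>n. d (x + real n)) \<longlonglongrightarrow> 0"
  proof (rule tendsto_sandwich[OF _ _ tendsto_const lim])
    show "\<forall>\<^sub>F n in sequentially. 0 \<le> d (x + real n)"
      unfolding d_def using assms by (auto intro!: Polygamma_real_mono always_eventually)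
    have "d y \<le> fact k / y ^ Suc k" if "0 < y" for y
      using step[OF that] Polygamma_real_mono[of "y + a" "y + 1" k] assms that
      by (simp add: d_def)
    then show "\<forall>\<^sub>F n in sequentially. d (x + real n) \<le> fact k / (x + real n) ^ Suc k"
      using assms by (intro always_eventually allI) auto
  qed
  from tendsto_diff[OF this lim] have "(\<lambda>n. g (x + real n)) \<longlonglongrightarrow> 0"
    unfolding g_def by simp
  from telescope_sums'[OF this]
  have "(\<lambda>n. g (x + real n) - g (x + real (Suc n))) sums g x"
    by simp
  moreover have gap: "g y - g (y + 1) = fact k * chord_gap a (Suc k) y" if "0 < y" for y
  proof -
    have "d y - d (y + 1) = fact k / y ^ Suc k - fact k / (y + a) ^ Suc k"
      using step[of y] step[of "y + a"] that assms by (simp add: d_def add_ac)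
    then show ?thesis
      unfolding g_def chord_gap_def
      by (simp add: right_diff_distrib distrib_left left_diff_distrib diff_divide_distrib mult.commute)
  qed
  have "g (x + real n) - g (x + real (Suc n)) = fact k * chord_gap a (Suc k) (x + real n)" for n
    using gap[of "x + real n"] assms(4) by (simp add: add.assoc add.commute[of 1])
  ultimately show ?thesis
    by (simp add: g_def d_def)
qed

theorem corollary2p5:
  fixes a x :: real and k :: nat
  assumes "0 < a" and "a < 1" and "even k" and "1 < x"
  shows "a * fact k / x ^ (k + 1) < Polygamma k (x + a) - Polygamma k x \<and>
         Polygamma k (x + a) - Polygamma k x
           < Polygamma k a - Polygamma k 1 + fact k * (a / x ^ (k + 1) + 1 / a ^ (k + 1) - a)"
proof -
  let ?g = "\<lambda>x. Polygamma k (x + a) - Polygamma k x - a * fact k / x ^ Suc k"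
  let ?h = "\<lambda>x n. fact k * chord_gap a (Suc k) (x + real n)"
  have sums_x: "?h x sums ?g x" and sums_1: "?h 1 sums ?g 1"
    by (rule Polygamma_diff_sums_chord_gap; use assms in simp)+
  have "0 < ?g x"
    unfolding sums_unique[OF sums_x]
    using sums_x assms by (intro suminf_pos) (auto simp: sums_iff intro!: mult_pos_pos chord_gap_pos)
  \<comment> \<open>Subtracting the two series termwise gives positive terms, since
    \<open>1 < x\<close>.\<close>
  moreover have "0 < ?g 1 - ?g x"
    unfolding sums_unique[OF sums_diff[OF sums_1 sums_x]]
    using sums_diff[OF sums_1 sums_x] assms
    by (intro suminf_pos) (auto simp: sums_iff intro!: chord_gap_strict_antimono)
  \<comment> \<open>This produces the term \<open>1 / a ^ (k + 1)\<close> of the upper bound; its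
    \<open>- a\<close> is the fraction in \<open>?g 1\<close>.\<close>
  moreover have "Polygamma k (1 + a) = Polygamma k a + fact k / a ^ Suc k"
    using Polygamma_plus1[of a k] assms by (simp add: add.commute)
  ultimately show ?thesis
    by (simp add: algebra_simps)
qed

end
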